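(* Let $V$ be a (complex) Banach space, let $A=(a_{ij})\in AA(\mathbb{R},\mathbb{C}^{p\times p})$ be upper triangular, let $f\in AA(\mathbb{R},V^p)$, and consider the system $y'=A(t)y+f(t)$. Then the following assertions are valid. (i) Assume that $\mathrm{Re}(M(a_{ii}))\ne0$ for all $i=1,\dots,p$. Then a solution $y$ of the system is bounded if and only if $y\in AA(\mathbb{R},V^p)$. (ii) Assume that $a_{kk}(t)=i\beta_k(t)$ with $\beta_k$ real-valued and $\int_0^t\beta_k(s)\,ds$ bounded for all $k=1,\dots,p$, and that the Banach space $V$ has the Bohl-Bohr property. Then any solution $y$ of the system is bounded if and only if $y$ belongs to $AA(\mathbb{R},V^p)$.
   Context: For a Banach space $W$, $AA(\mathbb{R},W)$ is the set of almost automorphic functions: continuous $\psi:\mathbb{R}\to W$ such that every real sequence has a subsequence $\{\tau_n\}$ for which $\tilde\psi(t)=\lim_n\psi(t+\tau_n)$ and $\psi(t)=\lim_n\tilde\psi(t-\tau_n)$ (pointwise) for all $t\in\mathbb{R}$. A bounded continuous function $h$ is ergodic if the limit $M(h)=\lim_{T\to\infty}\frac1{2T}\int_{-T+\xi}^{T+\xi}h(s)\,ds$ exists uniformly with respect to $\xi\in\mathbb{R}$ and is independent of $\xi$; $M(h)$ is its mean. The mean is only defined for ergodic functions, so the hypothesis $\mathrm{Re}(M(a_{ii}))\ne0$ includes that $a_{ii}$ is ergodic. A Banach space $V$ has the Bohl-Bohr property if for every $f\in AA(\mathbb{R},V)$ the function $F(t)=\int_0^tf(s)\,ds$ is in $AA(\mathbb{R},V)$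 if and only if it is bounded. *)

theory Defs
  imports "HOL-Analysis.Analysis"
begin

text \<open>The distribution only has real Banach spaces; a complex one is a real Banach space whose
  scalar multiplication extends to the complex numbers, with an absolutely homogeneous norm.\<close>

class complex_banach = banach +
  fixes scaleC :: "complex \<Rightarrow> 'a \<Rightarrow> 'a" (infixr "*\<^sub>C" 75)
  assumes scaleC_add_right: "c *\<^sub>C (x + y) = c *\<^sub>C x + c *\<^sub>C y"
    and scaleC_add_left: "(c + d) *\<^sub>C x = c *\<^sub>C x + d *\<^sub>C x"
    and scaleC_scaleC: "c *\<^sub>C (d *\<^sub>C x) = (c * d) *\<^sub>C x"
    and scaleC_of_real: "complex_of_real r *\<^sub>C x = r *\<^sub>R x"
    and norm_scaleC: "norm (c *\<^sub>C x) = cmod c * norm x"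

instantiation complex :: complex_banach
begin

definition scaleC_complex :: "complex \<Rightarrow> complex \<Rightarrow> complex"
  where "scaleC_complex c z = c * z"

instance
  by standard (simp_all add: scaleC_complex_def algebra_simps norm_mult scaleR_conv_of_real)

end

definition AA :: "(real \<Rightarrow> 'a::banach) set"
  where "AA = {\<psi>. continuous_on UNIV \<psi> \<and>
    (\<forall>s :: nat \<Rightarrow> real. \<exists>(r :: nat \<Rightarrow> nat) \<psi>'. strict_mono r \<and>
      (\<forall>t. (\<lambda>n. \<psi> (t + s (r n))) \<longlonglongrightarrow> \<psi>' t) \<and>
      (\<forall>t. (\<lambda>n. \<psi>' (t - s (r n))) \<longlonglongrightarrow> \<psi> t))}"

text \<open>The limit being constant in \<open>\<xi>\<close> expresses independence of \<open>\<xi>\<close>. \<open>mean h\<close> is only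
  meaningful when \<open>ergodic h\<close> holds.\<close>

definition has_mean :: "(real \<Rightarrow> 'a::banach) \<Rightarrow> 'a \<Rightarrow> bool"
  where "has_mean h m \<longleftrightarrow>
    uniform_limit UNIV (\<lambda>T \<xi>. (1 / (2 * T)) *\<^sub>R integral {- T + \<xi>..T + \<xi>} h) (\<lambda>\<xi>. m) at_top"

definition ergodic :: "(real \<Rightarrow> 'a::banach) \<Rightarrow> bool"
  where "ergodic h \<longleftrightarrow> continuous_on UNIV h \<and> bounded (range h) \<and> (\<exists>m. has_mean h m)"

definition mean :: "(real \<Rightarrow> 'a::banach) \<Rightarrow> 'a"
  where "mean h = (THE m. has_mean h m)"

text \<open>Oriented integral from \<open>0\<close> to \<open>t\<close>, for either sign of \<open>t\<close>. The library's oriented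
  interval integral is not used because it is restricted to second countable codomains.\<close>

definition primitive0 :: "(real \<Rightarrow> 'a::banach) \<Rightarrow> real \<Rightarrow> 'a"
  where "primitive0 f t = (if 0 \<le> t then integral {0..t} f else - integral {t..0} f)"

definition bohl_bohr :: "'v::banach itself \<Rightarrow> bool"
  where "bohl_bohr _ \<longleftrightarrow>
    (\<forall>f :: real \<Rightarrow> 'v. f \<in> AA \<longrightarrow> (primitive0 f \<in> AA \<longleftrightarrow> bounded (range (primitive0 f))))"

definition upper_triangular :: "'a::zero ^ 'p::{finite,linorder} ^ 'p::{finite,linorder} \<Rightarrow> bool"
  where "upper_triangular B \<longleftrightarrow> (\<forall>i j. j < i \<longrightarrow> B $ i $ j = 0)"

definition matrix_apply :: "complex ^ 'p::finite ^ 'p \<Rightarrow> 'v::complex_banach ^ 'p \<Rightarrow> 'v ^ 'p"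
  where "matrix_apply B v = (\<chi> i. \<Sum>j\<in>UNIV. (B $ i $ j) *\<^sub>C (v $ j))"

definition solves_system ::
  "(real \<Rightarrow> complex ^ 'p::finite ^ 'p) \<Rightarrow> (real \<Rightarrow> 'v::complex_banach ^ 'p) \<Rightarrow>
    (real \<Rightarrow> 'v ^ 'p) \<Rightarrow> bool"
  where "solves_system A f y \<longleftrightarrow>
    (\<forall>t. (y has_vector_derivative (matrix_apply (A t) (y t) + f t)) (at t))"

end

theory Submission
  imports Defs
begin

text \<open>By back substitution it suffices to treat a scalar equation \<open>y' = a y + g\<close> with \<open>a\<close> and \<open>g\<close>
  almost automorphic. If \<open>Re (M(a)) \<noteq> 0\<close>, the factor \<open>exp (\<integral>a)\<close> over windows of length \<open>2 T\<close> tends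
  to zero uniformly in one of the two time directions, so a bounded solution is a uniform limit of
  integrals over bounded windows; a subsequence that works for \<open>a\<close> and \<open>g\<close> works for all these
  integrals. If \<open>a = \<i> \<beta>\<close> with \<open>\<beta>\<close> of bounded primitive, the Bohl-Bohr property of \<open>V\<close> passes to
  scalars, so the integrating factor \<open>exp (- \<i> \<integral>\<beta>)\<close> is almost automorphic and unimodular, and the
  equation reduces to integrating an almost automorphic function.\<close>

section \<open>Almost automorphic functions\<close>

text \<open>The sequence is kept fixed here and the extraction of a subsequence is left to
  \<open>AA_iff_shift_limit\<close>, so that several functions can be followed along one common
  sequence.\<close>

definition shift_limit :: "(nat \<Rightarrow> real) \<Rightarrow> (real \<Rightarrow> 'a::topological_space) \<Rightarrow> (real \<Rightarrow> 'a) \<Rightarrow> bool"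
  where "shift_limit s \<psi> \<psi>' \<longleftrightarrow>
    (\<forall>t. (\<lambda>n. \<psi> (t + s n)) \<longlonglongrightarrow> \<psi>' t) \<and> (\<forall>t. (\<lambda>n. \<psi>' (t - s n)) \<longlonglongrightarrow> \<psi> t)"

lemma AA_iff_shift_limit:
  "\<psi> \<in> AA \<longleftrightarrow> continuous_on UNIV \<psi> \<and>
    (\<forall>s. \<exists>r \<psi>'. strict_mono (r :: nat \<Rightarrow> nat) \<and> shift_limit (s \<circ> r) \<psi> \<psi>')"
  by (simp add: AA_def shift_limit_def)

lemma shift_limit_subseq:
  assumes "shift_limit s \<psi> \<psi>'" and "strict_mono r"
  shows "shift_limit (s \<circ> r) \<psi> \<psi>'"
  unfolding shift_limit_def
proof (intro conjI allI)
  fix t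
  have "(\<lambda>n. \<psi> (t + s n)) \<longlonglongrightarrow> \<psi>' t" "(\<lambda>n. \<psi>' (t - s n)) \<longlonglongrightarrow> \<psi> t"
    using assms(1) by (simp_all add: shift_limit_def)
  from this[THEN LIMSEQ_subseq_LIMSEQ, OF assms(2)]
  show "(\<lambda>n. \<psi> (t + (s \<circ> r) n)) \<longlonglongrightarrow> \<psi>' t" "(\<lambda>n. \<psi>' (t - (s \<circ> r) n)) \<longlonglongrightarrow> \<psi> t"
    by (simp_all add: o_def)
qed

lemma shift_limit_compose:
  assumes "shift_limit s \<psi> \<psi>'" and "continuous_on UNIV h"
  shows "shift_limit s (\<lambda>t. h (\<psi> t)) (\<lambda>t. h (\<psi>' t))"
  using assms(1) continuous_on_tendsto_compose[OF assms(2)] by (auto simp: shift_limit_def)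

lemma shift_limit_translate:
  assumes "shift_limit s \<psi> \<psi>'"
  shows "shift_limit s (\<lambda>t. \<psi> (t + c)) (\<lambda>t. \<psi>' (t + c))"
  unfolding shift_limit_def
proof (intro conjI allI)
  fix t
  show "(\<lambda>n. \<psi> (t + s n + c)) \<longlonglongrightarrow> \<psi>' (t + c)"
    using assms by (auto simp: shift_limit_def add_ac dest: spec[of _ "t + c"])
  have "(\<lambda>n. \<psi>' ((t + c) - s n)) \<longlonglongrightarrow> \<psi> (t + c)"
    using assms by (auto simp: shift_limit_def)
  then show "(\<lambda>n. \<psi>' (t - s n + c)) \<longlonglongrightarrow> \<psi> (t + c)"
    by (simp add: algebra_simps)
qed

lemma shift_limit_Pair:
  assumes "shift_limit s \<psi> \<psi>'" and "shift_limit s \<phi> \<phi>'"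
  shows "shift_limit s (\<lambda>t. (\<psi> t, \<phi> t)) (\<lambda>t. (\<psi>' t, \<phi>' t))"
  using assms by (auto simp: shift_limit_def intro: tendsto_Pair)

lemma AA_compose:
  assumes "\<psi> \<in> AA" and "continuous_on UNIV h"
  shows "(\<lambda>t. h (\<psi> t)) \<in> AA"
  unfolding AA_iff_shift_limit
proof (intro conjI allI)
  show "continuous_on UNIV (\<lambda>t. h (\<psi> t))"
    using assms by (auto simp: AA_iff_shift_limit intro: continuous_on_compose2)
  fix s
  show "\<exists>r \<psi>'. strict_mono (r :: nat \<Rightarrow> nat) \<and> shift_limit (s \<circ> r) (\<lambda>t. h (\<psi> t)) \<psi>'"
    using assms(1) shift_limit_compose[OF _ assms(2)] unfolding AA_iff_shift_limit by blast
qed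

text \<open>Two successive extractions give one sequence that serves both functions, since the first
  shift limit survives the second extraction. Sums and products then follow as continuous images of
  a pair.\<close>

lemma AA_Pair:
  assumes "\<psi> \<in> AA" and "\<phi> \<in> AA"
  shows "(\<lambda>t. (\<psi> t, \<phi> t)) \<in> AA"
  unfolding AA_iff_shift_limit
proof (intro conjI allI)
  show "continuous_on UNIV (\<lambda>t. (\<psi> t, \<phi> t))"
    using assms by (auto simp: AA_iff_shift_limit intro: continuous_on_Pair)
  fix s :: "nat \<Rightarrow> real"
  obtain r \<psi>' where r: "strict_mono (r :: nat \<Rightarrow> nat)" "shift_limit (s \<circ> r) \<psi> \<psi>'"
    using assms(1) unfolding AA_iff_shift_limit by meson
  obtain q \<phi>' where q: "strict_mono (q :: nat \<Rightarrow> nat)" "shift_limit (s \<circ> r \<circ> q) \<phi> \<phi>'"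
    using assms(2) unfolding AA_iff_shift_limit by meson
  have "shift_limit (s \<circ> (r \<circ> q)) (\<lambda>t. (\<psi> t, \<phi> t)) (\<lambda>t. (\<psi>' t, \<phi>' t))"
    using shift_limit_Pair[OF shift_limit_subseq[OF r(2) q(1)] q(2)] by (simp add: o_assoc)
  then show "\<exists>r \<psi>'. strict_mono (r :: nat \<Rightarrow> nat) \<and>
      shift_limit (s \<circ> r) (\<lambda>t. (\<psi> t, \<phi> t)) \<psi>'"
    using strict_mono_o[OF r(1) q(1)] by blast
qed

lemma AA_compose2:
  assumes "\<psi> \<in> AA" and "\<phi> \<in> AA" and "continuous_on UNIV (\<lambda>p. h (fst p) (snd p))"
  shows "(\<lambda>t. h (\<psi> t) (\<phi> t)) \<in> AA"
  using AA_compose[OF AA_Pair[OF assms(1,2)] assms(3)] by simp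

lemma AA_const: "(\<lambda>t. c) \<in> AA"
proof -
  have "strict_mono (id :: nat \<Rightarrow> nat) \<and> shift_limit (s \<circ> id) (\<lambda>t. c) (\<lambda>t. c)" for s
    by (simp add: strict_mono_def shift_limit_def)
  then show ?thesis
    unfolding AA_iff_shift_limit by (blast intro: continuous_on_const)
qed

lemma AA_add:
  assumes "\<psi> \<in> AA" and "\<phi> \<in> AA"
  shows "(\<lambda>t. \<psi> t + \<phi> t) \<in> AA"
  using AA_compose2[OF assms, of "(+)"]
  by (simp add: continuous_on_add continuous_on_fst continuous_on_snd)

lemma AA_sum:
  assumes "\<And>i. i \<in> S \<Longrightarrow> \<psi> i \<in> AA"
  shows "(\<lambda>t. \<Sum>i\<in>S. \<psi> i t) \<in> AA"
  using assms by (induction S rule: infinite_finite_induct) (simp_all add: AA_const AA_add)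

lemma AA_vec_nth: "\<psi> \<in> AA \<Longrightarrow> (\<lambda>t. \<psi> t $ i) \<in> AA"
  by (rule AA_compose[of \<psi> "\<lambda>v. v $ i"]) (auto intro!: continuous_intros)

text \<open>The vector is rebuilt as a finite sum of its coordinates embedded by the continuous maps
  \<open>axis i\<close>, so closure under sums performs the common extraction.\<close>

lemma AA_vecI:
  fixes \<psi> :: "real \<Rightarrow> 'a::banach ^ 'n::finite"
  assumes "\<And>i. (\<lambda>t. \<psi> t $ i) \<in> AA"
  shows "\<psi> \<in> AA"
proof -
  have "continuous_on UNIV (axis i :: 'a \<Rightarrow> 'a ^ 'n)" for i
    unfolding axis_def
  proof (intro continuous_on_vec_lambda)
    show "continuous_on UNIV (\<lambda>x::'a. if j = i then x else 0)" for j
      by (cases "j = i") auto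
  qed
  then have "(\<lambda>t. \<Sum>i\<in>UNIV. axis i (\<psi> t $ i)) \<in> AA"
    by (intro AA_sum AA_compose[OF assms])
  moreover have "(\<Sum>i\<in>UNIV. axis i (\<psi> t $ i)) = \<psi> t" for t
    by (simp add: vec_eq_iff axis_def if_distrib[where f="\<lambda>x. x $ _"] sum.delta)
  ultimately show ?thesis by simp
qed

text \<open>Along points where the norm exceeds \<open>n\<close>, no subsequence can converge,
  whereas the shift limit at \<open>0\<close> demands a convergent one.\<close>

lemma AA_bounded:
  assumes "\<psi> \<in> AA"
  shows "bounded (range \<psi>)"
proof (rule ccontr)
  assume "\<not> bounded (range \<psi>)"
  then have "\<exists>t. norm (\<psi> t) > real n" for n :: nat
    by (auto simp: bounded_iff not_le)
  then obtain s where s: "\<And>n. norm (\<psi> (s n)) > real n"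
    by metis
  obtain r \<psi>' where r: "strict_mono (r :: nat \<Rightarrow> nat)" "shift_limit (s \<circ> r) \<psi> \<psi>'"
    using assms unfolding AA_iff_shift_limit by meson
  then have "(\<lambda>n. \<psi> (0 + (s \<circ> r) n)) \<longlonglongrightarrow> \<psi>' 0"
    unfolding shift_limit_def by blast
  then have "Bseq (\<lambda>n. \<psi> (s (r n)))"
    by (intro convergent_imp_Bseq) (auto simp: convergent_def)
  then obtain K where K: "\<And>n. norm (\<psi> (s (r n))) \<le> K"
    by (auto simp: Bseq_def)
  \<comment> \<open>Since \<open>n \<le> r n\<close>, the value at \<open>s (r n)\<close> has norm
    above \<open>r n\<close>, hence above \<open>K\<close>.\<close>
  obtain n where "K < real n"
    using reals_Archimedean2 by blast
  then show False
    using K[of n] s[of "r n"] seq_suble[OF r(1), of n] by simp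
qed

section \<open>Stability of shift limits\<close>

text \<open>Completeness produces the forward limit from a Cauchy estimate. The same sequence
  \<open>s\<close> must work for every accuracy \<open>e\<close>; this is what allows passing from
  integrals over bounded windows to the solution itself.\<close>

lemma shift_limit_uniform_approx:
  fixes y :: "real \<Rightarrow> 'a::banach"
  assumes "\<And>e. e > 0 \<Longrightarrow> \<exists>z z'. shift_limit s z z' \<and> (\<forall>t. norm (y t - z t) \<le> e)"
  shows "\<exists>y'. shift_limit s y y'"
proof -
  have "Cauchy (\<lambda>n. y (t + s n))" for t
  proof (rule metric_CauchyI)
    fix e :: real
    assume "e > 0"
    then obtain z z' where z: "shift_limit s z z'" "\<And>t. norm (y t - z t) \<le> e / 4"
      using assms[of "e / 4"] by auto
    have "Cauchy (\<lambda>n. z (t + s n))"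
      using z(1) by (auto simp: shift_limit_def intro: LIMSEQ_imp_Cauchy)
    then obtain M where M: "\<And>m n. m \<ge> M \<Longrightarrow> n \<ge> M \<Longrightarrow> dist (z (t + s m)) (z (t + s n)) < e / 4"
      using \<open>e > 0\<close> by (meson metric_CauchyD divide_pos_pos zero_less_numeral)
    have "dist (y (t + s m)) (y (t + s n)) < e" if "m \<ge> M" "n \<ge> M" for m n
      using M[OF that] z(2)[of "t + s m"] z(2)[of "t + s n"] \<open>e > 0\<close>
        dist_triangle[of "y (t + s m)" "y (t + s n)" "z (t + s m)"]
        dist_triangle[of "z (t + s m)" "y (t + s n)" "z (t + s n)"]
        dist_commute[of "z (t + s n)" "y (t + s n)"]
      unfolding dist_norm[of "y (t + s _)" "z (t + s _)"] by linarith
    then show "\<exists>M. \<forall>m\<ge>M. \<forall>n\<ge>M. dist (y (t + s m)) (y (t + s n)) < e"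
      by blast
  qed
  then have "\<exists>l. (\<lambda>n. y (t + s n)) \<longlonglongrightarrow> l" for t
    by (simp add: Cauchy_convergent_iff convergent_def)
  then obtain y' where y': "\<And>t. (\<lambda>n. y (t + s n)) \<longlonglongrightarrow> y' t"
    by metis
  have "(\<lambda>n. y' (t - s n)) \<longlonglongrightarrow> y t" for t
  proof (rule metric_LIMSEQ_I)
    fix e :: real
    assume "e > 0"
    then obtain z z' where z: "shift_limit s z z'" "\<And>t. norm (y t - z t) \<le> e / 4"
      using assms[of "e / 4"] by auto
    \<comment> \<open>The uniform error survives the forward limit, so \<open>z'\<close>
      approximates \<open>y'\<close> as well as \<open>z\<close> approximates \<open>y\<close>; the
      backward limit of \<open>z'\<close> can then be transferred to \<open>y'\<close>.\<close>
    have z': "norm (y' u - z' u) \<le> e / 4" for u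
    proof (rule LIMSEQ_le_const2)
      show "(\<lambda>n. norm (y (u + s n) - z (u + s n))) \<longlonglongrightarrow> norm (y' u - z' u)"
        using z(1) y' by (auto simp: shift_limit_def intro!: tendsto_intros)
    qed (use z(2) in auto)
    have "(\<lambda>n. z' (t - s n)) \<longlonglongrightarrow> z t"
      using z(1) by (simp add: shift_limit_def)
    then obtain M where M: "\<And>n. n \<ge> M \<Longrightarrow> dist (z' (t - s n)) (z t) < e / 4"
      using \<open>e > 0\<close> by (meson metric_LIMSEQ_D divide_pos_pos zero_less_numeral)
    have "dist (y' (t - s n)) (y t) < e" if "n \<ge> M" for n
      using M[OF that] z(2)[of t] z'[of "t - s n"] \<open>e > 0\<close>
        dist_triangle[of "y' (t - s n)" "y t" "z' (t - s n)"]
        dist_triangle[of "z' (t - s n)" "y t" "z t"] dist_commute[of "z t" "y t"]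
      unfolding dist_norm[of "y' _" "z' _"] dist_norm[of "y t" "z t"] by linarith
    then show "\<exists>M. \<forall>n\<ge>M. dist (y' (t - s n)) (y t) < e"
      by blast
  qed
  with y' show ?thesis
    by (auto simp: shift_limit_def)
qed

text \<open>The pointwise limit \<open>x\<close> need not be continuous, and vector-valued dominated convergence is not
  available in a Banach space that is not second countable. Only the real functions
  \<open>\<lambda>u. norm (x u - w u)\<close> are integrated; this suffices because the integrals form a Cauchy
  sequence.\<close>

lemma integral_pointwise_limit:
  fixes x :: "nat \<Rightarrow> real \<Rightarrow> 'a::banach"
  assumes cont: "\<And>n. continuous_on {c..d} (x n)"
    and bound: "\<And>n u. u \<in> {c..d} \<Longrightarrow> norm (x n u) \<le> K"
    and lim: "\<And>u. u \<in> {c..d} \<Longrightarrow> (\<lambda>n. x n u) \<longlonglongrightarrow> x' u"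
  shows "\<exists>J. (\<lambda>n. integral {c..d} (x n)) \<longlonglongrightarrow> J \<and>
    (\<forall>w. continuous_on {c..d} w \<longrightarrow> (\<lambda>u. norm (x' u - w u)) integrable_on {c..d} \<and>
      norm (J - integral {c..d} w) \<le> integral {c..d} (\<lambda>u. norm (x' u - w u)))"
proof -
  \<comment> \<open>A continuous \<open>w\<close> is bounded by some \<open>L\<close> on the compact
    interval, so \<open>K + L\<close> is a majorant; real dominated convergence also yields
    integrability of the limit.\<close>
  have dom: "(\<lambda>u. norm (x' u - w u)) integrable_on {c..d} \<and>
      (\<lambda>n. integral {c..d} (\<lambda>u. norm (x n u - w u)))
        \<longlonglongrightarrow> integral {c..d} (\<lambda>u. norm (x' u - w u))"
    if w: "continuous_on {c..d} w" for w
  proof -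
    have "bounded (w ` {c..d})"
      by (intro compact_imp_bounded compact_continuous_image w compact_Icc)
    then obtain L where L: "\<And>u. u \<in> {c..d} \<Longrightarrow> norm (w u) \<le> L"
      unfolding bounded_iff by blast
    have 1: "(\<lambda>u. norm (x n u - w u)) integrable_on {c..d}" for n
      by (intro integrable_continuous_interval continuous_intros cont w)
    have 2: "(\<lambda>u. K + L) integrable_on {c..d}"
      by (intro integrable_continuous_interval continuous_intros)
    have 3: "norm (norm (x n u - w u)) \<le> K + L" if "u \<in> {c..d}" for n u
      using bound[OF that, of n] L[OF that] norm_triangle_ineq4[of "x n u" "w u"] by simp
    have 4: "(\<lambda>n. norm (x n u - w u)) \<longlonglongrightarrow> norm (x' u - w u)" if "u \<in> {c..d}" for u
      by (intro tendsto_intros lim that)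
    show ?thesis
      using dominated_convergence[OF 1 2 3 4] by blast
  qed
  have diff: "norm (integral {c..d} (x n) - integral {c..d} w)
      \<le> integral {c..d} (\<lambda>u. norm (x n u - w u))" if w: "continuous_on {c..d} w" for n w
  proof -
    have "integral {c..d} (x n) - integral {c..d} w = integral {c..d} (\<lambda>u. x n u - w u)"
      by (intro integral_diff[symmetric] integrable_continuous_interval cont w)
    also have "norm \<dots> \<le> integral {c..d} (\<lambda>u. norm (x n u - w u))"
      by (intro integral_norm_bound_integral integrable_continuous_interval continuous_intros
          cont w) auto
    finally show ?thesis .
  qed
  \<comment> \<open>This is the L1 distance from \<open>x n\<close> to the pointwise limit. It tends
    to \<open>0\<close>, and the triangle inequality through \<open>x'\<close> bounds the distance
    of the \<open>m\<close>-th and \<open>n\<close>-th integrals by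
    \<open>h m + h n\<close>.\<close>
  define h where "h n = integral {c..d} (\<lambda>u. norm (x' u - x n u))" for n
  have "(\<lambda>n. integral {c..d} (\<lambda>u. norm (x' u - x n u))) \<longlonglongrightarrow> integral {c..d} (\<lambda>u. 0::real)"
  proof (rule dominated_convergence(2))
    show "(\<lambda>u. norm (x' u - x n u)) integrable_on {c..d}" for n
      using dom[OF cont] by blast
    show "(\<lambda>u. K + K) integrable_on {c..d}"
      by (intro integrable_continuous_interval continuous_intros)
    show "norm (norm (x' u - x n u)) \<le> K + K" if "u \<in> {c..d}" for n u
    proof -
      have "norm (x' u) \<le> K"
        by (rule LIMSEQ_le_const2[OF tendsto_norm[OF lim[OF that]]]) (use bound that in auto)
      then show ?thesis
        using bound[OF that, of n] norm_triangle_ineq4[of "x' u" "x n u"] by simp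
    qed
    show "(\<lambda>n. norm (x' u - x n u)) \<longlonglongrightarrow> 0" if "u \<in> {c..d}" for u
      using tendsto_norm[OF tendsto_diff[OF tendsto_const lim[OF that]], of "x' u"] by simp
  qed
  then have h0: "h \<longlonglongrightarrow> 0"
    by (simp add: h_def[abs_def])
  have "Cauchy (\<lambda>n. integral {c..d} (x n))"
  proof (rule metric_CauchyI)
    fix e :: real
    assume "e > 0"
    then obtain M where M: "\<And>n. n \<ge> M \<Longrightarrow> norm (h n) < e / 2"
      using LIMSEQ_D[OF h0, of "e / 2"] by auto
    have "dist (integral {c..d} (x m)) (integral {c..d} (x n)) < e" if "m \<ge> M" "n \<ge> M" for m n
    proof -
      have "integral {c..d} (\<lambda>u. norm (x m u - x n u))
          \<le> integral {c..d} (\<lambda>u. norm (x' u - x m u) + norm (x' u - x n u))"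
      proof (rule integral_le)
        show "(\<lambda>u. norm (x m u - x n u)) integrable_on {c..d}"
          by (intro integrable_continuous_interval continuous_intros cont)
        show "(\<lambda>u. norm (x' u - x m u) + norm (x' u - x n u)) integrable_on {c..d}"
          using dom[OF cont] by (intro integrable_add) auto
        show "norm (x m u - x n u) \<le> norm (x' u - x m u) + norm (x' u - x n u)" for u
          using norm_triangle_ineq4[of "x' u - x n u" "x' u - x m u"] by simp
      qed
      also have "\<dots> = h m + h n"
        unfolding h_def using dom[OF cont] by (intro integral_add) auto
      finally show ?thesis
        using diff[OF cont, of m n] M[OF that(1)] M[OF that(2)] by (simp add: dist_norm)
    qed
    then show "\<exists>M. \<forall>m\<ge>M. \<forall>n\<ge>M. dist (integral {c..d} (x m)) (integral {c..d} (x n)) < e"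
      by blast
  qed
  then obtain J where J: "(\<lambda>n. integral {c..d} (x n)) \<longlonglongrightarrow> J"
    by (auto simp: Cauchy_convergent_iff convergent_def)
  have "norm (J - integral {c..d} w) \<le> integral {c..d} (\<lambda>u. norm (x' u - w u))"
    if w: "continuous_on {c..d} w" for w
    by (rule LIMSEQ_le[OF tendsto_norm[OF tendsto_diff[OF J tendsto_const]]
          conjunct2[OF dom[OF w]]]) (use diff[OF w] in blast)
  with J dom show ?thesis
    by blast
qed

text \<open>\<open>I'\<close> is obtained as the limit of the shifted integrals, not as an integral
  of \<open>\<Phi>'\<close>. The backward limit therefore relies on the comparison of
  \<open>I'\<close> with integrals of continuous functions.\<close>

lemma shift_limit_integral:
  fixes \<Phi> :: "real \<Rightarrow> real \<Rightarrow> 'a::banach"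
  assumes lim: "\<And>u. u \<in> {c..d} \<Longrightarrow> shift_limit s (\<lambda>t. \<Phi> t u) (\<lambda>t. \<Phi>' t u)"
    and cont: "\<And>t. continuous_on {c..d} (\<Phi> t)"
    and bound: "\<And>t u. u \<in> {c..d} \<Longrightarrow> norm (\<Phi> t u) \<le> K"
  shows "\<exists>I'. shift_limit s (\<lambda>t. integral {c..d} (\<Phi> t)) I'"
proof -
  have forward: "(\<lambda>n. \<Phi> (t + s n) u) \<longlonglongrightarrow> \<Phi>' t u"
    and backward: "(\<lambda>n. \<Phi>' (t - s n) u) \<longlonglongrightarrow> \<Phi> t u" if "u \<in> {c..d}" for t u
    using lim[OF that] by (auto simp: shift_limit_def)
  have "\<forall>t. \<exists>J. (\<lambda>n. integral {c..d} (\<Phi> (t + s n))) \<longlonglongrightarrow> J \<and>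
    (\<forall>w. continuous_on {c..d} w \<longrightarrow> (\<lambda>u. norm (\<Phi>' t u - w u)) integrable_on {c..d} \<and>
      norm (J - integral {c..d} w) \<le> integral {c..d} (\<lambda>u. norm (\<Phi>' t u - w u)))"
    by (intro allI integral_pointwise_limit[OF cont bound forward])
  from choice[OF this] obtain I' where
    I': "\<And>t. (\<lambda>n. integral {c..d} (\<Phi> (t + s n))) \<longlonglongrightarrow> I' t"
    and int: "\<And>t w. continuous_on {c..d} w \<Longrightarrow>
        (\<lambda>u. norm (\<Phi>' t u - w u)) integrable_on {c..d}"
    and le: "\<And>t w. continuous_on {c..d} w \<Longrightarrow>
        norm (I' t - integral {c..d} w) \<le> integral {c..d} (\<lambda>u. norm (\<Phi>' t u - w u))"
    by blast
  have "(\<lambda>n. I' (t - s n)) \<longlonglongrightarrow> integral {c..d} (\<Phi> t)" for t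
  proof -
    \<comment> \<open>The comparison function is \<open>\<Phi> t\<close>. The bound \<open>K\<close>
      passes to the pointwise limit \<open>\<Phi>'\<close>, which gives the majorant
      \<open>K + K\<close>.\<close>
    have "(\<lambda>n. integral {c..d} (\<lambda>u. norm (\<Phi>' (t - s n) u - \<Phi> t u)))
        \<longlonglongrightarrow> integral {c..d} (\<lambda>u. 0::real)"
    proof (rule dominated_convergence(2))
      show "(\<lambda>u. norm (\<Phi>' (t - s n) u - \<Phi> t u)) integrable_on {c..d}" for n
        by (rule int[OF cont])
      show "(\<lambda>u. K + K) integrable_on {c..d}"
        by (intro integrable_continuous_interval continuous_intros)
      show "norm (norm (\<Phi>' (t - s n) u - \<Phi> t u)) \<le> K + K" if "u \<in> {c..d}" for n u
      proof -
        have "norm (\<Phi>' (t - s n) u) \<le> K"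
          by (rule LIMSEQ_le_const2[OF tendsto_norm[OF forward[OF that]]])
            (use bound that in auto)
        then show ?thesis
          using bound[OF that, of t] norm_triangle_ineq4[of "\<Phi>' (t - s n) u" "\<Phi> t u"] by simp
      qed
      show "(\<lambda>n. norm (\<Phi>' (t - s n) u - \<Phi> t u)) \<longlonglongrightarrow> 0" if "u \<in> {c..d}" for u
        using tendsto_norm[OF tendsto_diff[OF backward[OF that] tendsto_const], of t "\<Phi> t u"]
        by simp
    qed
    moreover have "\<forall>\<^sub>F n in sequentially. norm (I' (t - s n) - integral {c..d} (\<Phi> t))
        \<le> integral {c..d} (\<lambda>u. norm (\<Phi>' (t - s n) u - \<Phi> t u))"
      using le[OF cont] by (intro always_eventually) blast
    ultimately have "(\<lambda>n. I' (t - s n) - integral {c..d} (\<Phi> t)) \<longlonglongrightarrow> 0"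
      using Lim_null_comparison by fastforce
    then show ?thesis
      by (simp add: LIM_zero_iff)
  qed
  with I' show ?thesis
    unfolding shift_limit_def by blast
qed

section \<open>Primitives and complex scalars\<close>

lemma integral_of_derivative:
  fixes F :: "real \<Rightarrow> 'a::banach"
  assumes "\<And>t. (F has_vector_derivative f t) (at t)" and "a \<le> b"
  shows "integral {a..b} f = F b - F a"
  by (rule integral_unique[OF fundamental_theorem_of_calculus[OF assms(2)
          has_vector_derivative_at_within[OF assms(1)]]])

lemma primitive0_of_derivative:
  fixes F :: "real \<Rightarrow> 'a::banach"
  assumes "\<And>t. (F has_vector_derivative f t) (at t)"
  shows "primitive0 f t = F t - F 0"
  by (simp add: primitive0_def integral_of_derivative[OF assms])

text \<open>Moving the base point from \<open>0\<close> to \<open>- R\<close> changes the primitive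
  by a constant and covers both signs of \<open>u\<close> by one formula, with \<open>t\<close> in
  the interior of \<open>{-R..R}\<close>.\<close>

lemma primitive0_has_vector_derivative:
  fixes f :: "real \<Rightarrow> 'a::banach"
  assumes "continuous_on UNIV f"
  shows "(primitive0 f has_vector_derivative f t) (at t)"
proof -
  define R where "R = \<bar>t\<bar> + 1"
  have int: "f integrable_on {a..b}" for a b
    by (intro integrable_continuous_interval continuous_on_subset[OF assms]) auto
  have eq: "integral {-R..u} f - integral {-R..0} f = primitive0 f u" if "u \<in> {-R<..<R}" for u
  proof (cases "0 \<le> u")
    case True
    then have "integral {- R..0} f + integral {0..u} f = integral {- R..u} f"
      by (intro Henstock_Kurzweil_Integration.integral_combine int) (auto simp: R_def)
    with True show ?thesis
      by (auto simp: primitive0_def algebra_simps)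
  next
    case False
    then have "integral {- R..u} f + integral {u..0} f = integral {- R..0} f"
      using that by (intro Henstock_Kurzweil_Integration.integral_combine int) auto
    with False show ?thesis
      by (auto simp: primitive0_def algebra_simps)
  qed
  have "((\<lambda>u. integral {-R..u} f) has_vector_derivative f t) (at t within {-R..R})"
    by (intro integral_has_vector_derivative continuous_on_subset[OF assms]) (auto simp: R_def)
  then have "((\<lambda>u. integral {-R..u} f) has_vector_derivative f t) (at t)"
    by (subst (asm) at_within_Icc_at) (auto simp: R_def)
  then have "((\<lambda>u. integral {-R..u} f - integral {-R..0} f) has_vector_derivative f t - 0) (at t)"
    by (intro derivative_intros)
  then have "((\<lambda>u. integral {-R..u} f - integral {-R..0} f) has_vector_derivative f t) (at t)"
    by simp
  then show ?thesis
    by (rule has_vector_derivative_transform_within_open[OF _ open_greaterThanLessThan _ eq])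
      (auto simp: R_def)
qed

lemma has_vector_derivative_translate:
  assumes "(F has_vector_derivative F') (at (t + u))"
  shows "((\<lambda>u. F (t + u)) has_vector_derivative F') (at u)"
proof -
  have "((\<lambda>u. t + u) has_vector_derivative 1) (at u)"
    by (auto intro!: derivative_eq_intros)
  from vector_diff_chain_at[OF this assms] show ?thesis
    by (simp add: o_def)
qed

section \<open>Complex scalar multiplication as a bounded bilinear map\<close>

lemma bounded_bilinear_scaleC:
  "bounded_bilinear (scaleC :: complex \<Rightarrow> 'v::complex_banach \<Rightarrow> 'v)"
proof (standard, goal_cases)
  case (3 r a b)
  show ?case
    by (metis scaleC_of_real scaleC_scaleC scaleR_conv_of_real)
next
  case (4 a r b)
  show ?case
    by (metis scaleC_of_real scaleC_scaleC mult.commute)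
next
  case 5
  show ?case
    by (rule exI[of _ 1]) (simp add: norm_scaleC)
qed (simp_all add: scaleC_add_left scaleC_add_right)

lemma scaleC_one: "1 *\<^sub>C x = x"
  using scaleC_of_real[of 1 x] by simp

lemma continuous_on_scaleC:
  fixes g :: "'b::topological_space \<Rightarrow> 'v::complex_banach"
  assumes "continuous_on S f" and "continuous_on S g"
  shows "continuous_on S (\<lambda>x. f x *\<^sub>C g x)"
  by (rule bounded_bilinear.continuous_on[OF bounded_bilinear_scaleC assms])

lemma AA_scaleC:
  fixes \<phi> :: "real \<Rightarrow> 'v::complex_banach"
  assumes "\<psi> \<in> AA" and "\<phi> \<in> AA"
  shows "(\<lambda>t. \<psi> t *\<^sub>C \<phi> t) \<in> AA"
  using AA_compose2[OF assms, of scaleC]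
  by (simp add: continuous_on_scaleC continuous_on_fst continuous_on_snd)

lemma AA_exp:
  fixes \<psi> :: "real \<Rightarrow> complex"
  shows "\<psi> \<in> AA \<Longrightarrow> (\<lambda>t. exp (\<psi> t)) \<in> AA"
  using AA_compose[of \<psi> exp] by (simp add: continuous_on_exp continuous_on_id)

section \<open>The scalar equation\<close>

text \<open>The product rule cancels the term with \<open>a\<close>. The constant \<open>k\<close>
  normalises the factor: \<open>k = P t\<close> makes it \<open>1\<close> at time \<open>t\<close>,
  and \<open>k = 0\<close> serves the neutral equation.\<close>

lemma integrating_factor:
  fixes y :: "real \<Rightarrow> 'v::complex_banach"
  assumes P: "(P has_vector_derivative a) (at u)"
    and y: "(y has_vector_derivative a *\<^sub>C y u + g) (at u)"
  shows "((\<lambda>u. exp (k - P u) *\<^sub>C y u) has_vector_derivative exp (k - P u) *\<^sub>C g) (at u)"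
proof -
  have "((\<lambda>u. k - P u) has_vector_derivative 0 - a) (at u)"
    by (intro derivative_intros P)
  from field_vector_diff_chain_at[OF this DERIV_exp]
  have "((\<lambda>u. exp (k - P u)) has_vector_derivative - a * exp (k - P u)) (at u)"
    by (simp add: o_def)
  from bounded_bilinear.has_vector_derivative[OF bounded_bilinear_scaleC this y]
  have "((\<lambda>u. exp (k - P u) *\<^sub>C y u) has_vector_derivative
      exp (k - P u) *\<^sub>C (a *\<^sub>C y u + g) + (- a * exp (k - P u)) *\<^sub>C y u) (at u)" .
  also have "exp (k - P u) *\<^sub>C (a *\<^sub>C y u + g) + (- a * exp (k - P u)) *\<^sub>C y u
      = exp (k - P u) *\<^sub>C g"
    using bounded_bilinear.minus_left[OF bounded_bilinear_scaleC, of "a * exp (k - P u)" "y u"]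
    by (simp add: scaleC_add_right scaleC_scaleC mult.commute)
  finally show ?thesis .
qed

text \<open>Variation of constants on a window of length \<open>\<bar>N\<bar>\<close> expresses \<open>y t\<close>, up to a uniformly small
  remainder, through an integral over a bounded interval, to which
  \<open>shift_limit_integral\<close> applies. The sign of \<open>N\<close> distinguishes the stable from the
  unstable case.\<close>

lemma bounded_solution_AA_hyperbolic:
  fixes g y :: "real \<Rightarrow> 'v::complex_banach"
  assumes a: "a \<in> AA" and g: "g \<in> AA"
    and P: "\<And>t. (P has_vector_derivative a t) (at t)"
    and y: "\<And>t. (y has_vector_derivative a t *\<^sub>C y t + g t) (at t)"
    and bdd: "bounded (range y)"
    and small: "\<And>e. e > 0 \<Longrightarrow> \<exists>N. \<forall>t. norm (exp (P t - P (t + N))) \<le> e"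
  shows "y \<in> AA"
proof -
  have conta: "continuous_on UNIV a" and contg: "continuous_on UNIV g"
    using a g by (auto simp: AA_iff_shift_limit)
  have contP: "continuous_on UNIV P" and conty: "continuous_on UNIV y"
    using P y by (meson continuous_at_imp_continuous_on has_vector_derivative_continuous)+
  obtain Ka where Ka: "\<And>t. norm (a t) \<le> Ka"
    using AA_bounded[OF a] by (auto simp: bounded_iff)
  obtain Kg where Kg: "\<And>t. norm (g t) \<le> Kg"
    using AA_bounded[OF g] by (auto simp: bounded_iff)
  obtain Ky where Ky: "Ky > 0" "\<And>t. norm (y t) \<le> Ky"
    using bdd by (auto simp: bounded_pos)
  have "Ka \<ge> 0"
    using order_trans[OF norm_ge_zero Ka] .
  \<comment> \<open>Up to sign this is the integral of \<open>a\<close> over a window of length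
    \<open>\<bar>u\<bar>\<close>. Hence it is bounded in \<open>t\<close> and has shift limits, even
    where \<open>P\<close> itself is unbounded.\<close>
  define Q where "Q u t = P t - P (t + u)" for u t
  have intQ: "integral {0..u} (\<lambda>v. a (t + v)) = - Q u t" if "u \<ge> 0" for t u
    using integral_of_derivative[OF has_vector_derivative_translate[OF P] that, of t]
    by (simp add: Q_def)
  have intQ': "integral {u..0} (\<lambda>v. a (t + v)) = Q u t" if "u \<le> 0" for t u
    using integral_of_derivative[OF has_vector_derivative_translate[OF P] that, of t]
    by (simp add: Q_def)
  have conta': "continuous_on S (\<lambda>v. a (t + v))" for S t
    by (rule continuous_on_compose2[OF conta]) (auto intro!: continuous_intros)
  have Qbound: "norm (Q u t) \<le> Ka * \<bar>u\<bar>" for u t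
  proof (cases "u \<ge> 0")
    case True
    then show ?thesis
      using integral_bound[OF True conta' Ka] by (simp add: intQ)
  next
    case False
    then show ?thesis
      using integral_bound[of u 0, OF _ conta' Ka] by (simp add: intQ')
  qed
  define \<Phi> where "\<Phi> t u = exp (Q u t) *\<^sub>C g (t + u)" for t u
  have cont\<Phi>: "continuous_on S (\<Phi> t)" for S t
    unfolding \<Phi>_def Q_def
    by (intro continuous_on_scaleC continuous_intros continuous_on_compose2[OF contP]
        continuous_on_compose2[OF contg]) auto
  have deriv: "((\<lambda>u. exp (Q u t) *\<^sub>C y (t + u)) has_vector_derivative \<Phi> t u) (at u)" for t u
    using has_vector_derivative_translate[OF integrating_factor[OF P y, of "P t" "t + u"]]
    by (simp add: \<Phi>_def Q_def)
  have "\<exists>r y'. strict_mono (r :: nat \<Rightarrow> nat) \<and> shift_limit (s \<circ> r) y y'" for s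
  proof -
    \<comment> \<open>This is the only extraction: the sequence found for the pair
      \<open>(a, g)\<close> serves all window lengths and all accuracies below.\<close>
    obtain r p where r: "strict_mono (r :: nat \<Rightarrow> nat)"
      and p: "shift_limit (s \<circ> r) (\<lambda>t. (a t, g t)) p"
      using AA_Pair[OF a g] unfolding AA_iff_shift_limit by meson
    define \<sigma> where "\<sigma> = s \<circ> r"
    obtain a' g' where a': "shift_limit \<sigma> a a'" and g': "shift_limit \<sigma> g g'"
      using shift_limit_compose[OF p, of fst] shift_limit_compose[OF p, of snd]
      by (auto simp: \<sigma>_def continuous_on_fst continuous_on_snd)
    have int_a: "\<exists>I'. shift_limit \<sigma> (\<lambda>t. integral {c..d} (\<lambda>v. a (t + v))) I'" for c d
      by (rule shift_limit_integral[OF shift_limit_translate[OF a'] conta' Ka])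
    have "\<exists>q. shift_limit \<sigma> (Q u) q" for u
    proof (cases "u \<ge> 0")
      case True
      obtain I' where "shift_limit \<sigma> (\<lambda>t. integral {0..u} (\<lambda>v. a (t + v))) I'"
        using int_a by blast
      from shift_limit_compose[OF this, of uminus] show ?thesis
        using True by (auto simp: intQ continuous_on_minus)
    next
      case False
      then show ?thesis
        using int_a[of u 0] by (auto simp: intQ')
    qed
    then obtain Q' where Q': "\<And>u. shift_limit \<sigma> (Q u) (Q' u)"
      by metis
    have \<Phi>': "shift_limit \<sigma> (\<lambda>t. \<Phi> t u) (\<lambda>t. exp (Q' u t) *\<^sub>C g' (t + u))" for u
      using shift_limit_compose[OF shift_limit_Pair[OF Q' shift_limit_translate[OF g']],
          of "\<lambda>p. exp (fst p) *\<^sub>C snd p" u u]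
      by (simp add: \<Phi>_def continuous_on_scaleC continuous_on_exp continuous_on_fst
          continuous_on_snd)
    have "\<exists>y'. shift_limit \<sigma> y y'"
    proof (rule shift_limit_uniform_approx)
      fix e :: real
      assume "e > 0"
      \<comment> \<open>The accuracy \<open>e / Ky\<close> compensates the bound \<open>Ky\<close>
        on \<open>y\<close> in the remainder \<open>exp (Q N t) *\<^sub>C y (t + N)\<close>.\<close>
      then obtain N where N: "\<And>t. norm (exp (Q N t)) \<le> e / Ky"
        using small[of "e / Ky"] Ky(1) by (auto simp: Q_def)
      define c d where "c = min 0 N" and "d = max 0 N"
      have "norm (\<Phi> t u) \<le> exp (Ka * \<bar>N\<bar>) * Kg" if "u \<in> {c..d}" for t u
      proof -
        have "\<bar>u\<bar> \<le> \<bar>N\<bar>"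
          using that by (auto simp: c_def d_def)
        then have "Re (Q u t) \<le> Ka * \<bar>N\<bar>"
          using complex_Re_le_cmod[of "Q u t"] Qbound[of u t] \<open>Ka \<ge> 0\<close>
          by (meson mult_left_mono order_trans)
        then show ?thesis
          unfolding \<Phi>_def norm_scaleC norm_exp_eq_Re
          by (intro mult_mono Kg) auto
      qed
      then obtain I' where I': "shift_limit \<sigma> (\<lambda>t. integral {c..d} (\<Phi> t)) I'"
        using shift_limit_integral[OF \<Phi>' cont\<Phi>] by meson
      \<comment> \<open>The point \<open>t\<close> is the left end of the window when
        \<open>N \<ge> 0\<close> and the right end otherwise, so \<open>y t\<close> enters the
        integral with opposite signs.\<close>
      define m :: real where "m = (if N \<ge> 0 then - 1 else 1)"
      have "y t - m *\<^sub>R integral {c..d} (\<Phi> t) = exp (Q N t) *\<^sub>C y (t + N)" for t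
        using integral_of_derivative[OF deriv, of c d t]
        by (auto simp: m_def c_def d_def Q_def scaleC_one)
      moreover have "norm (exp (Q N t) *\<^sub>C y (t + N)) \<le> e / Ky * Ky" for t
        unfolding norm_scaleC using N Ky \<open>e > 0\<close> by (intro mult_mono) auto
      ultimately have "norm (y t - m *\<^sub>R integral {c..d} (\<Phi> t)) \<le> e" for t
        using Ky(1) by simp
      moreover have "shift_limit \<sigma> (\<lambda>t. m *\<^sub>R integral {c..d} (\<Phi> t)) (\<lambda>t. m *\<^sub>R I' t)"
        by (rule shift_limit_compose[OF I']) (intro continuous_intros)
      ultimately show "\<exists>z z'. shift_limit \<sigma> z z' \<and> (\<forall>t. norm (y t - z t) \<le> e)"
        by blast
    qed
    with r show ?thesis
      by (auto simp: \<sigma>_def)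
  qed
  with conty show ?thesis
    by (simp add: AA_iff_shift_limit)
qed

section \<open>Means and the decay of exponential factors over long windows\<close>

lemma has_mean_unique:
  assumes "has_mean h m" and "has_mean h m'"
  shows "m = m'"
  using tendsto_uniform_limitI[OF assms(1)[unfolded has_mean_def] UNIV_I]
    tendsto_uniform_limitI[OF assms(2)[unfolded has_mean_def] UNIV_I]
  by (rule tendsto_unique[OF trivial_limit_at_top_linorder])

lemma has_mean_mean:
  assumes "ergodic h"
  shows "has_mean h (mean h)"
proof -
  have "\<exists>!m. has_mean h m"
    using assms has_mean_unique unfolding ergodic_def by blast
  then show ?thesis
    unfolding mean_def by (rule theI')
qed

text \<open>Over a window of length \<open>2 * T\<close> the increment of \<open>P\<close> differs
  from \<open>2 * T * m\<close> by less than \<open>2 * T * \<delta>\<close>, wherever the window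
  lies. Stepping forward if \<open>Re m > 0\<close> and backward if \<open>Re m < 0\<close> makes
  the factor small uniformly in \<open>t\<close>.\<close>

lemma exp_primitive_small:
  assumes P: "\<And>t. (P has_vector_derivative a t) (at t)"
    and m: "has_mean a m" "Re m \<noteq> 0" and "e > 0"
  shows "\<exists>N. \<forall>t. norm (exp (P t - P (t + N))) \<le> e"
proof -
  \<comment> \<open>Half of \<open>\<bar>Re m\<bar>\<close> may be lost to the error; the other half
    still gives the decay \<open>exp (- (2 * \<delta>) * T)\<close>.\<close>
  define \<delta> where "\<delta> = \<bar>Re m\<bar> / 2"
  have "\<delta> > 0"
    using m(2) by (simp add: \<delta>_def)
  have "\<forall>\<^sub>F T in at_top. \<forall>\<xi>. dist ((1 / (2 * T)) *\<^sub>R integral {- T + \<xi>..T + \<xi>} a) m < \<delta>"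
    using m(1) \<open>\<delta> > 0\<close> unfolding has_mean_def uniform_limit_iff by simp
  \<comment> \<open>The threshold is the value of \<open>T\<close> at which
    \<open>exp (- (2 * \<delta>) * T)\<close> equals \<open>e\<close>.\<close>
  then have "\<forall>\<^sub>F T in at_top. T > max 0 (- ln e / (2 * \<delta>)) \<and>
      (\<forall>\<xi>. dist ((1 / (2 * T)) *\<^sub>R integral {- T + \<xi>..T + \<xi>} a) m < \<delta>)"
    by (intro eventually_conj eventually_gt_at_top)
  then obtain T where T: "T > max 0 (- ln e / (2 * \<delta>))"
    and dist: "\<And>\<xi>. dist ((1 / (2 * T)) *\<^sub>R integral {- T + \<xi>..T + \<xi>} a) m < \<delta>"
    using eventually_happens'[OF trivial_limit_at_top_linorder] by blast
  have "T > 0" and "- (2 * \<delta>) * T < ln e"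
    using T \<open>\<delta> > 0\<close> by (simp_all add: field_simps)
  then have "exp (- (2 * \<delta>) * T) < e"
    using \<open>e > 0\<close> by (metis exp_less_cancel_iff exp_ln)
  note T = \<open>T > 0\<close> this
  have window: "\<bar>Re (P (\<xi> + T) - P (\<xi> - T)) - 2 * T * Re m\<bar> \<le> 2 * T * \<delta>" for \<xi>
  proof -
    have "integral {- T + \<xi>..T + \<xi>} a = P (\<xi> + T) - P (\<xi> - T)"
      using integral_of_derivative[OF P, of "- T + \<xi>" "T + \<xi>"] T(1) by (simp add: add.commute)
    then have "norm ((1 / (2 * T)) *\<^sub>R (P (\<xi> + T) - P (\<xi> - T)) - m) < \<delta>"
      using dist[of \<xi>] by (simp add: dist_norm)
    then have "\<bar>Re ((1 / (2 * T)) *\<^sub>R (P (\<xi> + T) - P (\<xi> - T)) - m)\<bar> < \<delta>"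
      using abs_Re_le_cmod order_le_less_trans by blast
    moreover have "Re ((1 / (2 * T)) *\<^sub>R (P (\<xi> + T) - P (\<xi> - T)) - m)
        = (Re (P (\<xi> + T) - P (\<xi> - T)) - 2 * T * Re m) / (2 * T)"
      using T(1) by (simp add: field_simps)
    ultimately show ?thesis
      using T(1) by (simp add: field_simps)
  qed
  define N where "N = (if Re m > 0 then 2 * T else - (2 * T))"
  have "Re (P t - P (t + N)) \<le> - (2 * \<delta>) * T" for t
  proof (cases "Re m > 0")
    case True
    then have Re_m: "Re m = 2 * \<delta>"
      by (simp add: \<delta>_def)
    \<comment> \<open>The window from \<open>t\<close> to \<open>t + N\<close> is centred at
      \<open>t + T\<close>; in the other case the centre is \<open>t - T\<close>.\<close>
    have "t + T + T = t + N" "t + T - T = t"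
      using True by (simp_all add: N_def)
    then have "\<bar>Re (P (t + N) - P t) - 2 * T * (2 * \<delta>)\<bar> \<le> 2 * T * \<delta>"
      using window[of "t + T"] Re_m by metis
    then show ?thesis
      by (simp add: abs_le_iff algebra_simps)
  next
    case False
    then have Re_m: "Re m = - (2 * \<delta>)"
      by (simp add: \<delta>_def)
    have "t - T + T = t" "t - T - T = t + N"
      using False by (simp_all add: N_def)
    then have "\<bar>Re (P t - P (t + N)) - 2 * T * (- (2 * \<delta>))\<bar> \<le> 2 * T * \<delta>"
      using window[of "t - T"] Re_m by metis
    then show ?thesis
      by (simp add: abs_le_iff algebra_simps)
  qed
  then have "exp (Re (P t - P (t + N))) \<le> exp (- (2 * \<delta>) * T)" for t
    unfolding exp_le_cancel_iff .
  then have "norm (exp (P t - P (t + N))) \<le> e" for t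
    unfolding norm_exp_eq_Re using T(2) by (meson less_imp_le order_trans)
  then show ?thesis
    by blast
qed

section \<open>The neutral equation, with purely imaginary coefficient of bounded primitive\<close>

text \<open>A nonzero vector \<open>v\<close> embeds the scalars into \<open>V\<close>, which transfers the Bohl-Bohr property.\<close>

lemma bohl_bohr_imp_AA_real:
  fixes v :: "'v::banach"
  assumes bb: "bohl_bohr TYPE('v)" and "v \<noteq> 0"
    and \<beta>: "(\<beta> :: real \<Rightarrow> real) \<in> AA" and bdd: "bounded (range (primitive0 \<beta>))"
  shows "primitive0 \<beta> \<in> AA"
proof -
  define B :: "real \<Rightarrow> real" where "B = primitive0 \<beta>"
  have cont: "continuous_on UNIV \<beta>"
    using \<beta> by (simp add: AA_iff_shift_limit)
  have dB: "(B has_vector_derivative \<beta> t) (at t)" for t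
    unfolding B_def by (rule primitive0_has_vector_derivative[OF cont])
  have contB: "continuous_on UNIV B"
    using dB by (meson continuous_at_imp_continuous_on has_vector_derivative_continuous)
  have "((\<lambda>t. B t *\<^sub>R v) has_vector_derivative \<beta> t *\<^sub>R v) (at t)" for t
    using bounded_linear.has_vector_derivative[OF bounded_linear_scaleR_left dB] .
  from primitive0_of_derivative[OF this]
  have prim: "primitive0 (\<lambda>t. \<beta> t *\<^sub>R v) = (\<lambda>t. B t *\<^sub>R v)"
    by (auto simp: B_def primitive0_def)
  have "bounded (range (\<lambda>t. B t *\<^sub>R v))"
    using bounded_linear_image[OF bdd bounded_linear_scaleR_left[of v]]
    by (simp add: image_image B_def)
  moreover have "(\<lambda>t. \<beta> t *\<^sub>R v) \<in> AA"
    by (rule AA_compose[OF \<beta>]) (intro continuous_intros)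
  ultimately have AA: "(\<lambda>t. B t *\<^sub>R v) \<in> AA"
    using bb prim unfolding bohl_bohr_def by metis
  \<comment> \<open>Multiplication by \<open>v\<close> scales distances by \<open>norm v\<close>,
    which is positive.\<close>
  have lim_iff: "(\<lambda>n. x n *\<^sub>R v) \<longlonglongrightarrow> l *\<^sub>R v \<longleftrightarrow> x \<longlonglongrightarrow> l" for x l
  proof -
    have "(\<lambda>n. x n *\<^sub>R v) \<longlonglongrightarrow> l *\<^sub>R v \<longleftrightarrow> (\<lambda>n. \<bar>x n - l\<bar> * norm v) \<longlonglongrightarrow> 0"
      by (subst LIM_zero_iff[symmetric], subst tendsto_norm_zero_iff[symmetric])
        (simp add: scaleR_diff_left[symmetric])
    also have "\<dots> \<longleftrightarrow> x \<longlonglongrightarrow> l"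
      using \<open>v \<noteq> 0\<close>
      by (subst LIM_zero_iff[of x, symmetric], subst tendsto_rabs_zero_iff[symmetric])
        (auto simp: tendsto_mult_right_iff[of "norm v" _ 0, simplified] mult.commute)
    finally show ?thesis .
  qed
  have "\<exists>r B'. strict_mono (r :: nat \<Rightarrow> nat) \<and> shift_limit (s \<circ> r) B B'" for s
  proof -
    obtain r w where r: "strict_mono (r :: nat \<Rightarrow> nat)"
      and w: "shift_limit (s \<circ> r) (\<lambda>t. B t *\<^sub>R v) w"
      using AA unfolding AA_iff_shift_limit by meson
    \<comment> \<open>The shift limit stays on the line spanned by \<open>v\<close>: the
      coefficients form a Cauchy sequence, and their limit is the coefficient of
      \<open>w t\<close>.\<close>
    have "\<exists>b. w t = b *\<^sub>R v" for t
    proof -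
      define x where "x n = B (t + (s \<circ> r) n)" for n
      have x: "(\<lambda>n. x n *\<^sub>R v) \<longlonglongrightarrow> w t"
        using w by (simp add: shift_limit_def x_def)
      have dist: "dist (x m *\<^sub>R v) (x n *\<^sub>R v) = dist (x m) (x n) * norm v" for m n
        by (simp add: dist_norm scaleR_diff_left[symmetric])
      have "Cauchy x"
      proof (rule metric_CauchyI)
        fix e :: real
        assume "e > 0"
        then have "e * norm v > 0"
          using \<open>v \<noteq> 0\<close> by simp
        from metric_CauchyD[OF LIMSEQ_imp_Cauchy[OF x] this]
        show "\<exists>M. \<forall>m\<ge>M. \<forall>n\<ge>M. dist (x m) (x n) < e"
          unfolding dist mult_less_cancel_right_pos[OF zero_less_norm_iff[THEN iffD2, OF \<open>v \<noteq> 0\<close>]] .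
      qed
      then obtain b where "x \<longlonglongrightarrow> b"
        unfolding Cauchy_convergent_iff convergent_def by blast
      from LIMSEQ_unique[OF x tendsto_scaleR[OF this tendsto_const]] show ?thesis
        by blast
    qed
    then obtain B' where B': "\<And>t. w t = B' t *\<^sub>R v"
      by metis
    have "shift_limit (s \<circ> r) B B'"
      using w unfolding shift_limit_def by (simp add: B' lim_iff)
    with r show ?thesis
      by blast
  qed
  with contB show ?thesis
    by (simp add: AA_iff_shift_limit B_def)
qed

text \<open>The factor \<open>exp (0 - P t)\<close> is unimodular because \<open>P\<close> is
  imaginary, and almost automorphic because \<open>P\<close> is. So \<open>z\<close> is bounded with
  derivative \<open>h\<close> in \<open>AA\<close>, and the Bohl-Bohr property of \<open>V\<close>
  applies to \<open>z - z 0\<close>.\<close>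

lemma bounded_solution_AA_neutral:
  fixes g y :: "real \<Rightarrow> 'v::complex_banach"
  assumes bb: "bohl_bohr TYPE('v)"
    and a: "a \<in> AA" "\<And>t. a t = \<i> * complex_of_real (\<beta> t)"
    and \<beta>: "bounded (range (primitive0 \<beta>))" and g: "g \<in> AA"
    and y: "\<And>t. (y has_vector_derivative a t *\<^sub>C y t + g t) (at t)"
    and bdd: "bounded (range y)"
  shows "y \<in> AA"
proof (cases "\<exists>v::'v. v \<noteq> 0")
  \<comment> \<open>In the zero space no vector is available to carry the scalars, but there every
    function is zero.\<close>
  case False
  then have "y = (\<lambda>t. 0)"
    by auto
  then show ?thesis
    using AA_const by metis
next
  case True
  then obtain v :: 'v where v: "v \<noteq> 0"
    by blast
  have "\<beta> = (\<lambda>t. Im (a t))"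
    by (simp add: a(2))
  then have \<beta>_AA: "\<beta> \<in> AA"
    using AA_compose[OF a(1), of Im] by (simp add: continuous_on_Im)
  define P where "P t = \<i> * complex_of_real (primitive0 \<beta> t)" for t
  have P_AA: "P \<in> AA"
    unfolding P_def
    by (rule AA_compose[OF bohl_bohr_imp_AA_real[OF bb v \<beta>_AA \<beta>]]) (intro continuous_intros)
  have "(primitive0 \<beta> has_vector_derivative \<beta> t) (at t)" for t
    using \<beta>_AA by (intro primitive0_has_vector_derivative) (simp add: AA_iff_shift_limit)
  from bounded_linear.has_vector_derivative[OF bounded_linear_mult_right
      bounded_linear.has_vector_derivative[OF bounded_linear_of_real this]]
  have P: "(P has_vector_derivative a t) (at t)" for t
    unfolding P_def[abs_def] a(2) .
  define z where "z t = exp (0 - P t) *\<^sub>C y t" for t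
  define h where "h t = exp (0 - P t) *\<^sub>C g t" for t
  have "(z has_vector_derivative h t) (at t)" for t
    unfolding z_def h_def by (rule integrating_factor[OF P y])
  then have prim: "primitive0 h = (\<lambda>t. z t + (- z 0))"
    using primitive0_of_derivative[of z h] by auto
  have "norm (z t) = norm (y t)" for t
    by (simp add: z_def norm_scaleC P_def norm_exp_eq_Re)
  then have "bounded (range z)"
    using bdd by (simp add: bounded_iff)
  then have "bounded (range (primitive0 h))"
    unfolding prim using bounded_translation[of "range z" "- z 0"]
    by (simp add: image_image add.commute)
  moreover have "h \<in> AA"
    unfolding h_def using AA_exp[OF AA_compose[OF P_AA, of "\<lambda>p. 0 - p"]]
    by (intro AA_scaleC g) (simp add: continuous_on_minus)
  ultimately have "(\<lambda>t. z t + (- z 0)) \<in> AA"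
    using bb prim unfolding bohl_bohr_def by metis
  from AA_add[OF this AA_const[of "z 0"]] have "z \<in> AA"
    by simp
  then have "(\<lambda>t. exp (P t) *\<^sub>C z t) \<in> AA"
    by (intro AA_scaleC AA_exp P_AA)
  then show ?thesis
    by (simp add: z_def scaleC_scaleC scaleC_one exp_minus)
qed

section \<open>Triangular systems\<close>

text \<open>Row \<open>i\<close> involves only components of index at least \<open>i\<close>, so
  each component solves a scalar equation whose inhomogeneity is built from later components. The
  assumption \<open>scalar\<close> isolates the one-dimensional result, so both diagonal conditions
  share this argument.\<close>

lemma triangular_solution_AA:
  fixes A :: "real \<Rightarrow> complex ^ 'p::{finite,linorder} ^ 'p::{finite,linorder}"
    and f y :: "real \<Rightarrow> 'v::complex_banach ^ 'p::{finite,linorder}"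
  assumes A: "A \<in> AA" "\<And>t. upper_triangular (A t)" and f: "f \<in> AA"
    and y: "solves_system A f y" "bounded (range y)"
    and scalar: "\<And>i (g :: real \<Rightarrow> 'v) x. g \<in> AA \<Longrightarrow> bounded (range x) \<Longrightarrow>
      (\<And>t. (x has_vector_derivative A t $ i $ i *\<^sub>C x t + g t) (at t)) \<Longrightarrow> x \<in> AA"
  shows "y \<in> AA"
proof (rule AA_vecI)
  fix i
  show "(\<lambda>t. y t $ i) \<in> AA"
  \<comment> \<open>The measure counts the indices above \<open>i\<close>, so the induction runs
    from the last row upwards; for the largest index the sum in \<open>g\<close> is empty.\<close>
  proof (induction i rule: measure_induct_rule[of "\<lambda>i. card {i<..}"])
    case (less i)
    have IH: "(\<lambda>t. y t $ j) \<in> AA" if "j \<in> {i<..}" for j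
    proof (rule less)
      have "{j<..} \<subset> {i<..}"
        using that by auto
      then show "card {j<..} < card {i<..}"
        by (intro psubset_card_mono) auto
    qed
    define g where "g t = (\<Sum>j\<in>{i<..}. A t $ i $ j *\<^sub>C y t $ j) + f t $ i" for t
    have "g \<in> AA"
      unfolding g_def by (intro AA_add AA_sum AA_scaleC AA_vec_nth IH A f)
    moreover have "bounded (range (\<lambda>t. y t $ i))"
      using bounded_component_cart[OF y(2)] by (simp add: image_image)
    moreover have "((\<lambda>t. y t $ i) has_vector_derivative A t $ i $ i *\<^sub>C y t $ i + g t) (at t)" for t
    proof -
      have "(\<Sum>j\<in>UNIV. A t $ i $ j *\<^sub>C y t $ j) = (\<Sum>j\<in>insert i {i<..}. A t $ i $ j *\<^sub>C y t $ j)"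
      proof (rule sum.mono_neutral_right)
        show "\<forall>j\<in>UNIV - insert i {i<..}. A t $ i $ j *\<^sub>C y t $ j = 0"
        proof
          fix j
          assume "j \<in> UNIV - insert i {i<..}"
          then have "A t $ i $ j = 0"
            using A(2)[of t] by (auto simp: upper_triangular_def not_less)
          then show "A t $ i $ j *\<^sub>C y t $ j = 0"
            by (simp add: bounded_bilinear.zero_left[OF bounded_bilinear_scaleC])
        qed
      qed auto
      then have "(matrix_apply (A t) (y t) + f t) $ i = A t $ i $ i *\<^sub>C y t $ i + g t"
        by (simp add: matrix_apply_def g_def add.assoc)
      moreover have "(y has_vector_derivative matrix_apply (A t) (y t) + f t) (at t)"
        using y(1) by (simp add: solves_system_def)
      ultimately show ?thesis
        using bounded_linear.has_vector_derivative[OF bounded_linear_vec_nth] by metis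
    qed
    ultimately show ?case
      by (rule scalar)
  qed
qed

theorem theorem3p2:
  fixes A :: "real \<Rightarrow> complex ^ 'p::{finite,linorder} ^ 'p::{finite,linorder}"
    and f :: "real \<Rightarrow> 'v::complex_banach ^ 'p::{finite,linorder}"
  assumes "A \<in> AA"
    and "\<And>t. upper_triangular (A t)"
    and "f \<in> AA"
  shows
    "((\<forall>i. ergodic (\<lambda>t. A t $ i $ i) \<and> Re (mean (\<lambda>t. A t $ i $ i)) \<noteq> 0) \<longrightarrow>
        (\<forall>y. solves_system A f y \<longrightarrow> (bounded (range y) \<longleftrightarrow> y \<in> AA)))
     \<and>
     ((\<forall>k. \<exists>\<beta> :: real \<Rightarrow> real. (\<forall>t. A t $ k $ k = \<i> * complex_of_real (\<beta> t)) \<and>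
          bounded (range (primitive0 \<beta>))) \<and> bohl_bohr TYPE('v) \<longrightarrow>
        (\<forall>y. solves_system A f y \<longrightarrow> (bounded (range y) \<longleftrightarrow> y \<in> AA)))"
proof -
  have diag: "(\<lambda>t. A t $ i $ i) \<in> AA" for i
    by (intro AA_vec_nth assms(1))
  have hyperbolic: "y \<in> AA"
    if H: "\<forall>i. ergodic (\<lambda>t. A t $ i $ i) \<and> Re (mean (\<lambda>t. A t $ i $ i)) \<noteq> 0"
      and y: "solves_system A f y" "bounded (range y)" for y
  proof (rule triangular_solution_AA[OF assms y])
    fix i and g x :: "real \<Rightarrow> 'v"
    assume x: "g \<in> AA" "bounded (range x)"
      "\<And>t. (x has_vector_derivative A t $ i $ i *\<^sub>C x t + g t) (at t)"
    have P: "(primitive0 (\<lambda>t. A t $ i $ i) has_vector_derivative A t $ i $ i) (at t)" for t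
      using diag by (intro primitive0_has_vector_derivative) (simp add: AA_iff_shift_limit)
    have "has_mean (\<lambda>t. A t $ i $ i) (mean (\<lambda>t. A t $ i $ i))"
      and "Re (mean (\<lambda>t. A t $ i $ i)) \<noteq> 0"
      using H by (auto intro: has_mean_mean)
    from bounded_solution_AA_hyperbolic[OF diag x(1) P x(3,2) exp_primitive_small[OF P this]]
    show "x \<in> AA" .
  qed
  have neutral: "y \<in> AA"
    if H: "\<forall>k. \<exists>\<beta> :: real \<Rightarrow> real. (\<forall>t. A t $ k $ k = \<i> * complex_of_real (\<beta> t)) \<and>
        bounded (range (primitive0 \<beta>))"
      and bb: "bohl_bohr TYPE('v)"
      and y: "solves_system A f y" "bounded (range y)" for y
  proof (rule triangular_solution_AA[OF assms y])
    fix i and g x :: "real \<Rightarrow> 'v"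
    assume x: "g \<in> AA" "bounded (range x)"
      "\<And>t. (x has_vector_derivative A t $ i $ i *\<^sub>C x t + g t) (at t)"
    obtain \<beta> :: "real \<Rightarrow> real" where "\<And>t. A t $ i $ i = \<i> * complex_of_real (\<beta> t)"
      "bounded (range (primitive0 \<beta>))"
      using H by meson
    from bounded_solution_AA_neutral[OF bb diag this x(1,3,2)]
    show "x \<in> AA" .
  qed
  \<comment> \<open>The converse implications hold because every almost automorphic function is
    bounded.\<close>
  show ?thesis
    using hyperbolic neutral AA_bounded by blast
qed

end
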